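(* Let $V$ be a separable right quaternionic Hilbert space and let $\{u_i\}_{i\in I}$ be a frame for $V$ with lower and upper frame bounds $A$ and $B$, respectively. Let $\{v_i\}_{i\in I}$ be a sequence in $V$ and assume that there exist $\lambda,\mu\ge 0$ such that $\lambda+\dfrac{\mu}{\sqrt{A}}<1$ and $$\Big\|\sum_{i\in J}(u_i-v_i)q_i\Big\|\le\lambda\Big\|\sum_{i\in J}u_iq_i\Big\|+\mu\Big(\sum_{i\in J}|q_i|^2\Big)^{1/2}$$ for every finite subset $J\subseteq I$ and all quaternions $q_i\in\mathfrak{Q}$, $i\in J$. Then $\{v_i\}_{i\in I}$ is a frame for $V$ with lower and upper frame bounds $$A\Big(1-\Big(\lambda+\frac{\mu}{\sqrt{A}}\Big)\Big)^2\quad\text{and}\quad B\Big(1+\Big(\lambda+\frac{\mu}{\sqrt{B}}\Big)\Big)^2,$$ respectively.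
   Context: $\mathfrak{Q}$ denotes the (non-commutative) field of real quaternions, with conjugation $\overline{q}$ and modulus $|q|=(\overline{q}q)^{1/2}$. A right quaternionic Hilbert space $V$ is a right $\mathfrak{Q}$-vector space with an inner product $\langle\cdot|\cdot\rangle:V\times V\to\mathfrak{Q}$ satisfying $\overline{\langle v|w\rangle}=\langle w|v\rangle$, $\langle v|v\rangle>0$ for $v\neq0$, additivity in the second argument, and $\langle v|uq\rangle=\langle v|u\rangle q$ for $q\in\mathfrak{Q}$ (hence $\langle vq|u\rangle=\overline{q}\langle v|u\rangle$), and which is complete for the norm $\|u\|=\sqrt{\langle u|u\rangle}$. $I$ is a nonempty index set. A sum over $I$ of nonnegative reals is the supremum (in $[0,+\infty]$) of its finite partial sums. $\{u_i\}_{i\in I}\subset V$ is a frame for $V$ with lower frame bound $A$ and upper frame bound $B$ ($0<A\le B<\infty$) if $A\|u\|^2\le\sum_{i\in I}|\langle u_i|u\rangle|^2\le B\|u\|^2$ for all $u\in V$. *)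

theory Defs
  imports "HOL-Analysis.Analysis"
begin

section \<open>Quaternions\<close>

text \<open>\<open>Quat a b c d\<close> stands for \<open>a + b i + c j + d k\<close>.\<close>

codatatype quat = Quat (qRe: real) (qIm1: real) (qIm2: real) (qIm3: real)

lemma quat_eqI [intro?]:
  "qRe x = qRe y \<Longrightarrow> qIm1 x = qIm1 y \<Longrightarrow> qIm2 x = qIm2 y \<Longrightarrow> qIm3 x = qIm3 y \<Longrightarrow> x = y"
  by (rule quat.expand) simp

lemma quat_eq_iff:
  "x = y \<longleftrightarrow> qRe x = qRe y \<and> qIm1 x = qIm1 y \<and> qIm2 x = qIm2 y \<and> qIm3 x = qIm3 y"
  by (auto intro: quat.expand)

instantiation quat :: ab_group_add
begin

primcorec zero_quat where
  "qRe 0 = 0" | "qIm1 0 = 0" | "qIm2 0 = 0" | "qIm3 0 = 0"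

primcorec plus_quat where
  "qRe (x + y) = qRe x + qRe y"
| "qIm1 (x + y) = qIm1 x + qIm1 y"
| "qIm2 (x + y) = qIm2 x + qIm2 y"
| "qIm3 (x + y) = qIm3 x + qIm3 y"

primcorec uminus_quat where
  "qRe (- x) = - qRe x"
| "qIm1 (- x) = - qIm1 x"
| "qIm2 (- x) = - qIm2 x"
| "qIm3 (- x) = - qIm3 x"

primcorec minus_quat where
  "qRe (x - y) = qRe x - qRe y"
| "qIm1 (x - y) = qIm1 x - qIm1 y"
| "qIm2 (x - y) = qIm2 x - qIm2 y"
| "qIm3 (x - y) = qIm3 x - qIm3 y"

instance
  by standard (simp_all add: quat_eq_iff)

end

instantiation quat :: ring_1
begin

primcorec one_quat where
  "qRe 1 = 1" | "qIm1 1 = 0" | "qIm2 1 = 0" | "qIm3 1 = 0"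

primcorec times_quat where
  "qRe (x * y) = qRe x * qRe y - qIm1 x * qIm1 y - qIm2 x * qIm2 y - qIm3 x * qIm3 y"
| "qIm1 (x * y) = qRe x * qIm1 y + qIm1 x * qRe y + qIm2 x * qIm3 y - qIm3 x * qIm2 y"
| "qIm2 (x * y) = qRe x * qIm2 y - qIm1 x * qIm3 y + qIm2 x * qRe y + qIm3 x * qIm1 y"
| "qIm3 (x * y) = qRe x * qIm3 y + qIm1 x * qIm2 y - qIm2 x * qIm1 y + qIm3 x * qRe y"

instance
  by standard (simp_all add: quat_eq_iff algebra_simps)

end

instantiation quat :: real_algebra_1
begin

primcorec scaleR_quat where
  "qRe (scaleR r x) = r * qRe x"
| "qIm1 (scaleR r x) = r * qIm1 x"
| "qIm2 (scaleR r x) = r * qIm2 x"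
| "qIm3 (scaleR r x) = r * qIm3 x"

instance
  by standard (simp_all add: quat_eq_iff algebra_simps)

end

lemma quat_of_real_sel [simp]:
  "qRe (of_real r) = r" "qIm1 (of_real r) = 0" "qIm2 (of_real r) = 0" "qIm3 (of_real r) = 0"
  by (simp_all add: of_real_def)

primcorec qcnj :: "quat \<Rightarrow> quat" where
  "qRe (qcnj x) = qRe x"
| "qIm1 (qcnj x) = - qIm1 x"
| "qIm2 (qcnj x) = - qIm2 x"
| "qIm3 (qcnj x) = - qIm3 x"

lemma qcnj_simps [simp]:
  "qcnj (qcnj x) = x" "qcnj 0 = 0" "qcnj 1 = 1" "qcnj (of_real r) = of_real r"
  "qcnj (x + y) = qcnj x + qcnj y" "qcnj (x - y) = qcnj x - qcnj y" "qcnj (- x) = - qcnj x"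
  "qcnj (x * y) = qcnj y * qcnj x"
  by (simp_all add: quat_eq_iff)

instantiation quat :: real_normed_div_algebra
begin

text \<open>\<open>qcnj x * x\<close> is real, so taking its real part loses nothing
  (see \<open>qcnj_mult_self\<close> below).\<close>

definition norm_quat :: "quat \<Rightarrow> real" where
  "norm x = sqrt (qRe (qcnj x * x))"

definition sgn_quat :: "quat \<Rightarrow> quat" where
  "sgn x = x /\<^sub>R norm x" for x :: quat

definition dist_quat :: "quat \<Rightarrow> quat \<Rightarrow> real" where
  "dist x y = norm (x - y)" for x y :: quat

definition uniformity_quat :: "(quat \<times> quat) filter" where
  "uniformity = (INF e\<in>{0 <..}. principal {(x, y). dist x (y :: quat) < e})"

definition open_quat :: "quat set \<Rightarrow> bool" where
  "open U \<longleftrightarrow> (\<forall>x\<in>U. eventually (\<lambda>(x', y). x' = x \<longrightarrow> y \<in> U) uniformity)" for U :: "quat set"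

definition inverse_quat :: "quat \<Rightarrow> quat" where
  "inverse x = qcnj x /\<^sub>R (norm x)\<^sup>2"

definition divide_quat :: "quat \<Rightarrow> quat \<Rightarrow> quat" where
  "x div y = x * inverse y" for x y :: quat

instance
proof
  have N: "norm x = sqrt ((qRe x)\<^sup>2 + (qIm1 x)\<^sup>2 + (qIm2 x)\<^sup>2 + (qIm3 x)\<^sup>2)" for x :: quat
    by (simp add: norm_quat_def power2_eq_square)
  then have N2: "(norm x)\<^sup>2 = (qRe x)\<^sup>2 + (qIm1 x)\<^sup>2 + (qIm2 x)\<^sup>2 + (qIm3 x)\<^sup>2" for x :: quat
    by simp
  have N0: "norm x = 0 \<longleftrightarrow> x = 0" for x :: quat
    by (simp add: N quat_eq_iff add_nonneg_eq_0_iff)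
  have NP: "norm x = norm ((qRe x, qIm1 x), (qIm2 x, qIm3 x))" for x :: quat
    by (simp add: N norm_prod_def add.assoc)
  fix x y :: quat and r :: real
  show "(norm x = 0) = (x = 0)"
    by (rule N0)
  show "norm (x + y) \<le> norm x + norm y"
    using norm_triangle_ineq
      [of "((qRe x, qIm1 x), (qIm2 x, qIm3 x))" "((qRe y, qIm1 y), (qIm2 y, qIm3 y))"]
    by (simp add: NP)
  show "norm (r *\<^sub>R x) = \<bar>r\<bar> * norm x"
  proof -
    have "(norm (r *\<^sub>R x))\<^sup>2 = (\<bar>r\<bar> * norm x)\<^sup>2"
      by (simp only: N2 power_mult_distrib scaleR_quat.sel power2_abs) (simp add: algebra_simps)
    then show ?thesis
      by (rule power2_eq_imp_eq) (simp_all add: N)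
  qed
  show "norm (x * y) = norm x * norm y"
  proof -
    have "(norm (x * y))\<^sup>2 = (norm x * norm y)\<^sup>2"
      by (simp only: N2 power_mult_distrib times_quat.sel) (simp add: power2_eq_square algebra_simps)
    then show ?thesis
      by (rule power2_eq_imp_eq) (simp_all add: N)
  qed
  show "inverse x * x = 1" "x * inverse x = 1" if "x \<noteq> 0"
  proof -
    have nz: "(norm x)\<^sup>2 \<noteq> 0"
      using N0 that by simp
    have "qcnj x * x = (norm x)\<^sup>2 *\<^sub>R 1" "x * qcnj x = (norm x)\<^sup>2 *\<^sub>R 1"
      by (simp_all only: N2) (simp_all add: quat_eq_iff power2_eq_square)
    then show "inverse x * x = 1" "x * inverse x = 1"
      using nz by (simp_all add: inverse_quat_def)
  qed
  show "inverse (0 :: quat) = 0"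
    by (simp add: inverse_quat_def quat_eq_iff)
qed (simp_all only: sgn_quat_def dist_quat_def uniformity_quat_def open_quat_def divide_quat_def)

end

lemma norm_quat_alt:
  "norm x = sqrt ((qRe x)\<^sup>2 + (qIm1 x)\<^sup>2 + (qIm2 x)\<^sup>2 + (qIm3 x)\<^sup>2)"
  by (simp add: norm_quat_def power2_eq_square)

lemma qcnj_mult_self: "qcnj x * x = of_real ((norm x)\<^sup>2)"
  by (simp add: quat_eq_iff norm_quat_alt) (simp add: power2_eq_square)


section \<open>Right quaternionic Hilbert spaces\<close>

class scaleQ =
  fixes scaleQ :: "'a \<Rightarrow> quat \<Rightarrow> 'a"  (infixl "*\<^sub>Q" 75)

class right_quat_vector = ab_group_add + scaleQ +
  assumes scaleQ_add_left: "(x + y) *\<^sub>Q q = x *\<^sub>Q q + y *\<^sub>Q q"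
    and scaleQ_add_right: "x *\<^sub>Q (p + q) = x *\<^sub>Q p + x *\<^sub>Q q"
    and scaleQ_scaleQ: "(x *\<^sub>Q p) *\<^sub>Q q = x *\<^sub>Q (p * q)"
    and scaleQ_one: "x *\<^sub>Q 1 = x"

text \<open>The real structure, the norm and the topology are all determined by the quaternionic
  scalar multiplication and the inner product; they are class operations so that the library
  notions for real normed spaces apply. The axioms of \<^class>\<open>real_normed_vector\<close> restrict
  nothing: given \<open>scaleR_scaleQ\<close> and \<open>norm_eq_sqrt_qinner\<close> they either fix the derived
  operations or, like the triangle inequality (by Cauchy-Schwarz), follow from the axioms
  for \<open>*\<^sub>Q\<close> and \<open>qinner\<close>.\<close>

class right_quat_inner = right_quat_vector + real_normed_vector +
  fixes qinner :: "'a \<Rightarrow> 'a \<Rightarrow> quat"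
  assumes scaleR_scaleQ: "scaleR r x = x *\<^sub>Q of_real r"
    and qcnj_qinner: "qcnj (qinner x y) = qinner y x"
    and qinner_self_pos: "x \<noteq> 0 \<Longrightarrow> \<exists>r>0. qinner x x = of_real r"
    and qinner_add_right: "qinner x (y + z) = qinner x y + qinner x z"
    and qinner_scaleQ_right: "qinner x (y *\<^sub>Q q) = qinner x y * q"
    and norm_eq_sqrt_qinner: "norm x = sqrt (qRe (qinner x x))"

class right_quat_hilbert = right_quat_inner + banach

text \<open>The quaternions themselves form a right quaternionic Hilbert space.\<close>

instantiation quat :: right_quat_hilbert
begin
definition scaleQ_quat :: "quat \<Rightarrow> quat \<Rightarrow> quat" where
  "scaleQ_quat x q = x * q"
definition qinner_quat :: "quat \<Rightarrow> quat \<Rightarrow> quat" where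
  "qinner_quat x y = qcnj x * y"
instance
proof
  fix X :: "nat \<Rightarrow> quat" assume C: "Cauchy X"
  define f where "f x = ((qRe x, qIm1 x), (qIm2 x, qIm3 x))" for x
  define g where "g p = Quat (fst (fst p)) (snd (fst p)) (fst (snd p)) (snd (snd p))" for p
  have fg: "f (g p) = p" for p by (simp add: f_def g_def)
  have d: "dist x y = dist (f x) (f y)" for x y
    by (simp add: f_def dist_norm norm_quat_alt norm_prod_def add.assoc)
  have "Cauchy (\<lambda>n. f (X n))" using C by (simp add: Cauchy_def d)
  then obtain L where "(\<lambda>n. f (X n)) \<longlonglongrightarrow> L"
    using Cauchy_convergent convergent_def by blast
  then have "X \<longlonglongrightarrow> g L" by (simp add: lim_sequentially d fg)
  then show "convergent X" by (auto simp: convergent_def)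
next
  fix x :: quat assume "x \<noteq> 0"
  then show "\<exists>r>0. qinner x x = of_real r"
    by (intro exI[of _ "(norm x)\<^sup>2"]) (simp add: qinner_quat_def qcnj_mult_self)
qed (simp_all add: scaleQ_quat_def qinner_quat_def algebra_simps norm_quat_def scaleR_conv_of_real quat_eq_iff)
end


section \<open>Frames\<close>

definition nonneg_sum :: "('i \<Rightarrow> real) \<Rightarrow> 'i set \<Rightarrow> ennreal" where
  "nonneg_sum f I = (SUP J\<in>{J. finite J \<and> J \<subseteq> I}. ennreal (\<Sum>i\<in>J. f i))"

definition is_frame ::
  "'i set \<Rightarrow> ('i \<Rightarrow> 'v::right_quat_hilbert) \<Rightarrow> real \<Rightarrow> real \<Rightarrow> bool" where
  "is_frame I u A B \<longleftrightarrow> 0 < A \<and> A \<le> B \<and>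
     (\<forall>x. ennreal (A * (norm x)\<^sup>2) \<le> nonneg_sum (\<lambda>i. (norm (qinner (u i) x))\<^sup>2) I \<and>
          nonneg_sum (\<lambda>i. (norm (qinner (u i) x))\<^sup>2) I \<le> ennreal (B * (norm x)\<^sup>2))"

end

theory Submission
  imports Defs
begin

text \<open>Every \<open>x\<close> is approximated by finite sums \<open>\<Sum>i\<in>J. u i *\<^sub>Q q i\<close> with
  \<open>\<Sum>i\<in>J. (norm (q i))\<^sup>2 \<le> (norm x)\<^sup>2 / A\<close>: these sums form a bounded convex set whose support
  function at \<open>z\<close> is at least \<open>norm x * norm z\<close> by the lower frame bound, so \<open>x\<close> cannot be
  separated from it. By the perturbation hypothesis, \<open>\<Sum>i\<in>J. v i *\<^sub>Q q i\<close> then lies within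
  about \<open>(lam + mu / sqrt A) * norm x\<close> of \<open>x\<close>, and pairing it with \<open>x\<close> and applying
  Cauchy-Schwarz to the coefficients gives the lower bound for \<open>v\<close>. The upper bound holds because
  the analysis and synthesis operators have the same norm. The inverse of the frame operator is
  never needed.\<close>

section \<open>The quaternionic inner product\<close>

lemma abs_qRe_le_norm: "\<bar>qRe q\<bar> \<le> norm q"
  unfolding norm_quat_alt by (rule real_le_rsqrt) simp

lemma norm_qcnj [simp]: "norm (qcnj q) = norm q"
  by (simp add: norm_quat_alt)

lemma additive_qinner: "Modules.additive (qinner x)"
  by (simp add: Modules.additive_def qinner_add_right)

lemmas qinner_zero_right = Modules.additive.zero[OF additive_qinner]
lemmas qinner_diff_right = Modules.additive.diff[OF additive_qinner]
lemmas qinner_sum_right = Modules.additive.sum[OF additive_qinner]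

lemma qRe_qinner_commute: "qRe (qinner x y) = qRe (qinner y x)"
  by (metis qcnj.simps(1) qcnj_qinner)

lemma qRe_qinner_scaleR_right: "qRe (qinner x (r *\<^sub>R y)) = r * qRe (qinner x y)"
  by (simp add: scaleR_scaleQ qinner_scaleQ_right)

lemma power2_norm_eq_qinner: "(norm x)\<^sup>2 = qRe (qinner x x)"
  using norm_ge_zero[of x] by (simp add: norm_eq_sqrt_qinner)

lemma power2_norm_add:
  "(norm (x + y))\<^sup>2 = (norm x)\<^sup>2 + 2 * qRe (qinner x y) + (norm y)\<^sup>2"
proof -
  have "qRe (qinner (x + y) z) = qRe (qinner x z) + qRe (qinner y z)" for z
    by (metis plus_quat.simps(1) qRe_qinner_commute qinner_add_right)
  then show ?thesis
    by (simp add: power2_norm_eq_qinner qinner_add_right qRe_qinner_commute[of y x])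
qed

text \<open>Cauchy-Schwarz for the real part is read off from the triangle inequality, an axiom of
  the normed class, by expanding both squares.\<close>

lemma qRe_qinner_le_norm: "qRe (qinner x y) \<le> norm x * norm y"
proof -
  have "(norm (x + y))\<^sup>2 \<le> (norm x + norm y)\<^sup>2"
    by (intro power_mono norm_triangle_ineq) simp
  then show ?thesis
    by (simp add: power2_norm_add power2_sum)
qed

lemma scaleR_scaleQ_right: "r *\<^sub>R (x *\<^sub>Q q) = x *\<^sub>Q (r *\<^sub>R q)"
  for x :: "'v::right_quat_inner"
proof -
  have "q * of_real r = r *\<^sub>R q"
    by (simp add: quat_eq_iff)
  then show ?thesis
    by (simp add: scaleR_scaleQ scaleQ_scaleQ)
qed

lemma scaleQ_zero_right [simp]: "x *\<^sub>Q 0 = 0"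
  for x :: "'v::right_quat_vector"
  using scaleQ_add_right[of x 0 0] by simp

lemma scaleQ_diff_left: "(x - y) *\<^sub>Q q = x *\<^sub>Q q - y *\<^sub>Q q"
  for x :: "'v::right_quat_vector"
  using scaleQ_add_left[of "x - y" y q] by (simp add: algebra_simps)

section \<open>Approximation from bounded convex sets\<close>

text \<open>A quantitative form of Hahn-Banach separation. If \<open>x\<close> has distance
  \<open>d > 0\<close> from \<open>K\<close>, take \<open>k\<close> in \<open>K\<close> almost
  attaining that distance and \<open>z = x - k\<close>. Moving from \<open>k\<close> a little way
  towards any other point of \<open>K\<close> cannot gain much, so \<open>z\<close> separates up to
  an error \<open>d\<^sup>2 / 2\<close>, which is smaller than the gap
  \<open>(norm z)\<^sup>2\<close>.\<close>

lemma mem_closure_if_not_separated: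
  fixes K :: "'v::right_quat_inner set"
  assumes K: "convex K" "bounded K" "K \<noteq> {}"
    and sep: "\<And>z h. (\<And>k. k \<in> K \<Longrightarrow> qRe (qinner z k) \<le> h) \<Longrightarrow> qRe (qinner z x) \<le> h"
  shows "x \<in> closure K"
proof (rule ccontr)
  assume "x \<notin> closure K"
  define d where "d = infdist x K"
  have d: "d > 0"
    using \<open>x \<notin> closure K\<close> K(3) in_closure_iff_infdist_zero[of K x] infdist_nonneg[of x K]
    by (auto simp: d_def order_less_le)
  have dle: "d \<le> norm (x - k)" if "k \<in> K" for k
    using infdist_le[OF that, of x] by (simp add: d_def dist_norm)
  obtain D where D: "\<And>k k'. k \<in> K \<Longrightarrow> k' \<in> K \<Longrightarrow> norm (k' - k) \<le> D"
    using K(2) unfolding bounded_two_points dist_norm by blast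
  \<comment> \<open>Adding 1 keeps the denominator in \<open>t\<close> positive even when
    \<open>D\<close> is 0.\<close>
  define M where "M = D\<^sup>2 + 1"
  have M: "M > 0" "D\<^sup>2 \<le> M"
    by (simp_all add: M_def add_nonneg_pos)
  \<comment> \<open>\<open>t\<close> is the length of the step inside \<open>K\<close>: at most 1
    for convexity, and small enough that the quadratic term \<open>t\<^sup>2 * D\<^sup>2\<close>
    stays below \<open>t * d\<^sup>2 / 2\<close>.\<close>
  define t where "t = min 1 (d\<^sup>2 / (2 * M))"
  have t: "0 < t" "t \<le> 1"
    using d M by (auto simp: t_def)
  have tD: "t * D\<^sup>2 \<le> d\<^sup>2 / 2"
  proof -
    have "t * D\<^sup>2 \<le> d\<^sup>2 / (2 * M) * M"
      using t M by (intro mult_mono) (auto simp: t_def)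
    also have "\<dots> = d\<^sup>2 / 2"
      using M by simp
    finally show ?thesis .
  qed
  \<comment> \<open>The slack in the choice of \<open>k\<close> is proportional to \<open>t\<close>,
    so that it survives the later division by \<open>t\<close> as a constant.\<close>
  have "d < sqrt (d\<^sup>2 + t * d\<^sup>2 / 2)"
    using d t by (intro real_less_rsqrt) simp
  then obtain k where k: "k \<in> K" "dist x k < sqrt (d\<^sup>2 + t * d\<^sup>2 / 2)"
    using K(3) cInf_lessD[of "dist x ` K"] by (auto simp: d_def infdist_notempty)
  define z where "z = x - k"
  have "(norm z)\<^sup>2 < (sqrt (d\<^sup>2 + t * d\<^sup>2 / 2))\<^sup>2"
    using k(2) by (intro power_strict_mono) (auto simp: z_def dist_norm)
  then have z: "(norm z)\<^sup>2 < d\<^sup>2 + t * d\<^sup>2 / 2"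
    using t by simp
  \<comment> \<open>First-order variation: the point \<open>k + t *\<^sub>R (k' - k)\<close> is
    still at distance at least \<open>d\<close> from \<open>x\<close>. The slack and the quadratic
    term each cost at most \<open>t * d\<^sup>2 / 2\<close>.\<close>
  have "qRe (qinner z k') \<le> qRe (qinner z k) + d\<^sup>2 / 2" if "k' \<in> K" for k'
  proof -
    let ?w = "k' - k"
    have "k + t *\<^sub>R ?w \<in> K"
      using convexD_alt[OF K(1) k(1) that, of t] t by (simp add: algebra_simps)
    then have "d \<le> norm (z + (- t) *\<^sub>R ?w)"
      using dle by (fastforce simp: z_def algebra_simps)
    then have "d\<^sup>2 \<le> (norm (z + (- t) *\<^sub>R ?w))\<^sup>2"
      using d by (intro power_mono) auto
    also have "\<dots> = (norm z)\<^sup>2 - 2 * t * qRe (qinner z ?w) + t\<^sup>2 * (norm ?w)\<^sup>2"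
      by (simp only: power2_norm_add qRe_qinner_scaleR_right norm_scaleR power_mult_distrib) simp
    finally have "2 * t * qRe (qinner z ?w) \<le> t * d\<^sup>2 / 2 + t\<^sup>2 * (norm ?w)\<^sup>2"
      using z by simp
    also have "t\<^sup>2 * (norm ?w)\<^sup>2 \<le> t\<^sup>2 * D\<^sup>2"
      using D[OF k(1) that] by (intro mult_left_mono power_mono) auto
    also have "t\<^sup>2 * D\<^sup>2 \<le> t * (d\<^sup>2 / 2)"
      using mult_left_mono[OF tD, of t] t by (simp add: power2_eq_square mult.assoc)
    finally have "t * (2 * qRe (qinner z ?w)) \<le> t * d\<^sup>2"
      by (simp add: algebra_simps)
    then show ?thesis
      using t by (simp add: qinner_diff_right)
  qed
  then have "qRe (qinner z x) \<le> qRe (qinner z k) + d\<^sup>2 / 2"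
    by (rule sep)
  then have "(norm z)\<^sup>2 \<le> d\<^sup>2 / 2"
    by (simp add: z_def power2_norm_eq_qinner qinner_diff_right)
  moreover have "d\<^sup>2 \<le> (norm z)\<^sup>2"
    using dle[OF k(1)] d by (intro power_mono) (auto simp: z_def)
  moreover have "d\<^sup>2 > 0"
    using d by simp
  ultimately show False
    by linarith
qed

section \<open>Analysis and synthesis\<close>

text \<open>Synthesis is the adjoint of analysis. Real parts suffice here, since they form a real
  inner product with the same norm.\<close>

lemma qRe_qinner_synthesis:
  "qRe (qinner x (\<Sum>i\<in>J. u i *\<^sub>Q q i)) = (\<Sum>i\<in>J. qRe (qcnj (qinner (u i) x) * q i))"
proof -
  have "qRe (\<Sum>i\<in>J. f i) = (\<Sum>i\<in>J. qRe (f i))" for f :: "_ \<Rightarrow> quat"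
    by (rule Modules.additive.sum) (simp add: Modules.additive_def)
  then show ?thesis
    by (simp only: qinner_sum_right qinner_scaleQ_right qcnj_qinner)
qed

lemma qRe_qinner_synthesis_le:
  "qRe (qinner x (\<Sum>i\<in>J. u i *\<^sub>Q q i))
     \<le> L2_set (\<lambda>i. norm (qinner (u i) x)) J * L2_set (\<lambda>i. norm (q i)) J"
proof -
  have "qRe (qcnj (qinner (u i) x) * q i) \<le> \<bar>norm (qinner (u i) x)\<bar> * \<bar>norm (q i)\<bar>" for i
    using abs_qRe_le_norm[of "qcnj (qinner (u i) x) * q i"] by (simp add: norm_mult)
  then have "qRe (qinner x (\<Sum>i\<in>J. u i *\<^sub>Q q i))
      \<le> (\<Sum>i\<in>J. \<bar>norm (qinner (u i) x)\<bar> * \<bar>norm (q i)\<bar>)"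
    unfolding qRe_qinner_synthesis by (rule sum_mono)
  then show ?thesis
    by (rule order_trans[OF _ L2_set_mult_ineq])
qed

text \<open>This is the quadratic form of the partial frame operator; analysis coefficients turn
  Cauchy-Schwarz into an equality.\<close>

lemma qRe_qinner_synthesis_analysis:
  "qRe (qinner x (\<Sum>i\<in>J. u i *\<^sub>Q qinner (u i) x)) = (L2_set (\<lambda>i. norm (qinner (u i) x)) J)\<^sup>2"
  by (simp add: qRe_qinner_synthesis qcnj_mult_self L2_set_def sum_nonneg
      del: times_quat.simps of_real_power)

text \<open>An operator and its adjoint have the same bound: pair the sum with itself and cancel one
  factor of its norm. \<open>analysis_bound\<close> is the converse.\<close>

lemma synthesis_bound:
  assumes "\<And>x. L2_set (\<lambda>i. norm (qinner (u i) x)) J \<le> C * norm x" and "C \<ge> 0"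
  shows "norm (\<Sum>i\<in>J. u i *\<^sub>Q q i) \<le> C * L2_set (\<lambda>i. norm (q i)) J"
proof (cases "(\<Sum>i\<in>J. u i *\<^sub>Q q i) = 0")
  case True
  then show ?thesis
    using assms(2) by (simp add: L2_set_nonneg)
next
  case False
  let ?y = "\<Sum>i\<in>J. u i *\<^sub>Q q i"
  have "norm ?y * norm ?y
      \<le> L2_set (\<lambda>i. norm (qinner (u i) ?y)) J * L2_set (\<lambda>i. norm (q i)) J"
    using qRe_qinner_synthesis_le[of ?y u q J]
    by (simp add: power2_norm_eq_qinner flip: power2_eq_square)
  also have "\<dots> \<le> (C * norm ?y) * L2_set (\<lambda>i. norm (q i)) J"
    by (intro mult_right_mono assms L2_set_nonneg)
  finally have "norm ?y * norm ?y \<le> norm ?y * (C * L2_set (\<lambda>i. norm (q i)) J)"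
    by (simp add: mult_ac)
  then show ?thesis
    using False by simp
qed

lemma analysis_bound:
  assumes "\<And>q. norm (\<Sum>i\<in>J. u i *\<^sub>Q q i) \<le> C * L2_set (\<lambda>i. norm (q i)) J" and "C \<ge> 0"
  shows "L2_set (\<lambda>i. norm (qinner (u i) x)) J \<le> C * norm x"
proof (cases "L2_set (\<lambda>i. norm (qinner (u i) x)) J = 0")
  case True
  then show ?thesis
    using assms(2) by simp
next
  case False
  let ?s = "L2_set (\<lambda>i. norm (qinner (u i) x)) J"
  have "?s * ?s \<le> norm x * norm (\<Sum>i\<in>J. u i *\<^sub>Q qinner (u i) x)"
    using qRe_qinner_le_norm[of x "\<Sum>i\<in>J. u i *\<^sub>Q qinner (u i) x"]
    by (simp add: qRe_qinner_synthesis_analysis power2_eq_square)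
  also have "\<dots> \<le> norm x * (C * ?s)"
    by (intro mult_left_mono assms) simp
  finally have "?s * ?s \<le> ?s * (C * norm x)"
    by (simp add: mult_ac)
  moreover have "?s > 0"
    using False L2_set_nonneg[of "\<lambda>i. norm (qinner (u i) x)" J] by linarith
  ultimately show ?thesis
    by simp
qed

text \<open>The image under synthesis of the \<open>r\<close>-ball of finitely supported
  square-summable coefficients. Finite sums avoid convergence questions and let the perturbation
  hypothesis apply directly.\<close>

definition synthesis_ball :: "'i set \<Rightarrow> ('i \<Rightarrow> 'v::right_quat_inner) \<Rightarrow> real \<Rightarrow> 'v set" where
  "synthesis_ball I u r = {\<Sum>i\<in>J. u i *\<^sub>Q q i | J q.
     finite J \<and> J \<subseteq> I \<and> L2_set (\<lambda>i. norm (q i)) J \<le> r}"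

lemma synthesis_ballI:
  "finite J \<Longrightarrow> J \<subseteq> I \<Longrightarrow> L2_set (\<lambda>i. norm (q i)) J \<le> r
    \<Longrightarrow> (\<Sum>i\<in>J. u i *\<^sub>Q q i) \<in> synthesis_ball I u r"
  unfolding synthesis_ball_def by blast

text \<open>Padding with zeros brings two coefficient families to a common index set, as needed for
  convex combinations.\<close>

lemma synthesis_extend:
  fixes u :: "'i \<Rightarrow> 'v::right_quat_vector"
  assumes "finite L" "J \<subseteq> L" and p: "p = (\<lambda>i. if i \<in> J then q i else 0)"
  shows "(\<Sum>i\<in>L. u i *\<^sub>Q p i) = (\<Sum>i\<in>J. u i *\<^sub>Q q i)"
    and "L2_set (\<lambda>i. norm (p i)) L = L2_set (\<lambda>i. norm (q i)) J"
proof -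
  show "(\<Sum>i\<in>L. u i *\<^sub>Q p i) = (\<Sum>i\<in>J. u i *\<^sub>Q q i)"
    using assms(1,2) by (intro sum.mono_neutral_cong_right) (auto simp: p)
  have "(\<Sum>i\<in>L. (norm (p i))\<^sup>2) = (\<Sum>i\<in>J. (norm (q i))\<^sup>2)"
    using assms(1,2) by (intro sum.mono_neutral_cong_right) (auto simp: p)
  then show "L2_set (\<lambda>i. norm (p i)) L = L2_set (\<lambda>i. norm (q i)) J"
    by (simp add: L2_set_def)
qed

lemma convex_synthesis_ball: "convex (synthesis_ball I u r)"
proof (rule convexI)
  fix x y and s t :: real
  assume "x \<in> synthesis_ball I u r" "y \<in> synthesis_ball I u r"
    and st: "0 \<le> s" "0 \<le> t" "s + t = 1"
  then obtain J q J' q' where J: "finite J" "J \<subseteq> I" "L2_set (\<lambda>i. norm (q i)) J \<le> r"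
      "x = (\<Sum>i\<in>J. u i *\<^sub>Q q i)"
    and J': "finite J'" "J' \<subseteq> I" "L2_set (\<lambda>i. norm (q' i)) J' \<le> r"
      "y = (\<Sum>i\<in>J'. u i *\<^sub>Q q' i)"
    unfolding synthesis_ball_def by blast
  let ?L = "J \<union> J'"
  define p where "p = (\<lambda>i. if i \<in> J then q i else 0)"
  define p' where "p' = (\<lambda>i. if i \<in> J' then q' i else 0)"
  have L: "finite ?L" "?L \<subseteq> I"
    using J J' by auto
  have p: "(\<Sum>i\<in>?L. u i *\<^sub>Q p i) = x" "L2_set (\<lambda>i. norm (p i)) ?L \<le> r"
    using synthesis_extend[OF L(1) _ p_def] J by auto
  have p': "(\<Sum>i\<in>?L. u i *\<^sub>Q p' i) = y" "L2_set (\<lambda>i. norm (p' i)) ?L \<le> r"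
    using synthesis_extend[OF L(1) _ p'_def] J' by auto
  have "L2_set (\<lambda>i. norm (s *\<^sub>R p i + t *\<^sub>R p' i)) ?L
      \<le> L2_set (\<lambda>i. s * norm (p i) + t * norm (p' i)) ?L"
    using st by (intro L2_set_mono) (auto intro: norm_triangle_le)
  also have "\<dots> \<le> L2_set (\<lambda>i. s * norm (p i)) ?L + L2_set (\<lambda>i. t * norm (p' i)) ?L"
    by (rule L2_set_triangle_ineq)
  also have "\<dots> = s * L2_set (\<lambda>i. norm (p i)) ?L + t * L2_set (\<lambda>i. norm (p' i)) ?L"
    using st by (simp add: L2_set_right_distrib)
  also have "\<dots> \<le> s * r + t * r"
    using st p(2) p'(2) by (intro add_mono mult_left_mono) auto
  also have "\<dots> = r"
    using st by (simp flip: distrib_right)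
  finally have "(\<Sum>i\<in>?L. u i *\<^sub>Q (s *\<^sub>R p i + t *\<^sub>R p' i)) \<in> synthesis_ball I u r"
    by (rule synthesis_ballI[OF L])
  then show "s *\<^sub>R x + t *\<^sub>R y \<in> synthesis_ball I u r"
    by (simp add: scaleQ_add_right sum.distrib scaleR_sum_right scaleR_scaleQ_right
        flip: p(1) p'(1))
qed

text \<open>The support function of the ball at \<open>z\<close> is at least \<open>r\<close> times
  each partial analysis norm: test with the analysis coefficients rescaled to norm \<open>r\<close>.
  If they all vanish, no rescaling exists, and the point 0 of the ball gives
  \<open>h \<ge> 0\<close>.\<close>

lemma analysis_le_if_synthesis_ball_le:
  assumes J: "finite J" "J \<subseteq> I" and "r > 0"
    and h: "\<And>k. k \<in> synthesis_ball I u r \<Longrightarrow> qRe (qinner z k) \<le> h"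
  shows "r * L2_set (\<lambda>i. norm (qinner (u i) z)) J \<le> h"
proof (cases "L2_set (\<lambda>i. norm (qinner (u i) z)) J = 0")
  case True
  have "(0::'b) \<in> synthesis_ball I u r"
    using synthesis_ballI[of "{}" I _ r u] \<open>r > 0\<close> by simp
  then show ?thesis
    using h True by (force simp: qinner_zero_right)
next
  case False
  let ?s = "L2_set (\<lambda>i. norm (qinner (u i) z)) J"
  have s: "?s > 0"
    using False L2_set_nonneg[of "\<lambda>i. norm (qinner (u i) z)" J] by linarith
  let ?q = "\<lambda>i. (r / ?s) *\<^sub>R qinner (u i) z"
  have "L2_set (\<lambda>i. norm (?q i)) J = r / ?s * ?s"
    using s \<open>r > 0\<close> by (subst L2_set_right_distrib) auto
  then have "L2_set (\<lambda>i. norm (?q i)) J \<le> r"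
    using s by simp
  then have "qRe (qinner z (\<Sum>i\<in>J. u i *\<^sub>Q ?q i)) \<le> h"
    by (intro h synthesis_ballI J)
  moreover have "(\<Sum>i\<in>J. u i *\<^sub>Q ?q i) = (r / ?s) *\<^sub>R (\<Sum>i\<in>J. u i *\<^sub>Q qinner (u i) z)"
    by (simp only: scaleR_sum_right scaleR_scaleQ_right)
  ultimately have "r / ?s * ?s\<^sup>2 \<le> h"
    by (simp only: qRe_qinner_scaleR_right qRe_qinner_synthesis_analysis)
  then show ?thesis
    using s by (simp add: power2_eq_square)
qed

section \<open>Frame bounds through finite partial sums\<close>

lemma nonneg_sum_le_iff:
  assumes "C \<ge> 0"
  shows "nonneg_sum (\<lambda>i. (f i)\<^sup>2) I \<le> ennreal (C\<^sup>2)
    \<longleftrightarrow> (\<forall>J. finite J \<longrightarrow> J \<subseteq> I \<longrightarrow> L2_set f J \<le> C)"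
proof -
  have "(\<Sum>i\<in>J. (f i)\<^sup>2) \<le> C\<^sup>2 \<longleftrightarrow> L2_set f J \<le> C" for J
    using assms real_sqrt_le_iff[of "\<Sum>i\<in>J. (f i)\<^sup>2" "C\<^sup>2"] by (simp add: L2_set_def)
  then show ?thesis
    by (auto simp: nonneg_sum_def SUP_le_iff)
qed

text \<open>A lower bound of a supremum is a number below all upper bounds of the partial sums. By
  \<open>le\<close> the sum is a real \<open>M\<close>, so \<open>sqrt M\<close> is itself an
  admissible \<open>h\<close>.\<close>

lemma le_nonneg_sum_iff:
  assumes "c \<ge> 0" "C \<ge> 0" and le: "nonneg_sum (\<lambda>i. (f i)\<^sup>2) I \<le> ennreal (C\<^sup>2)"
  shows "ennreal (c\<^sup>2) \<le> nonneg_sum (\<lambda>i. (f i)\<^sup>2) I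
    \<longleftrightarrow> (\<forall>h. (\<forall>J. finite J \<longrightarrow> J \<subseteq> I \<longrightarrow> L2_set f J \<le> h) \<longrightarrow> c \<le> h)"
proof
  assume c: "ennreal (c\<^sup>2) \<le> nonneg_sum (\<lambda>i. (f i)\<^sup>2) I"
  show "\<forall>h. (\<forall>J. finite J \<longrightarrow> J \<subseteq> I \<longrightarrow> L2_set f J \<le> h) \<longrightarrow> c \<le> h"
  proof (intro allI impI)
    fix h assume h: "\<forall>J. finite J \<longrightarrow> J \<subseteq> I \<longrightarrow> L2_set f J \<le> h"
    then have "h \<ge> 0"
      by (auto dest: spec[of _ "{}"])
    then have "ennreal (c\<^sup>2) \<le> ennreal (h\<^sup>2)"
      using c h nonneg_sum_le_iff[of h f I] order_trans by blast
    then have "c\<^sup>2 \<le> h\<^sup>2"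
      by (simp add: ennreal_le_iff)
    then show "c \<le> h"
      using \<open>h \<ge> 0\<close> by (rule power2_le_imp_le)
  qed
next
  assume c: "\<forall>h. (\<forall>J. finite J \<longrightarrow> J \<subseteq> I \<longrightarrow> L2_set f J \<le> h) \<longrightarrow> c \<le> h"
  obtain M where M: "nonneg_sum (\<lambda>i. (f i)\<^sup>2) I = ennreal M" "M \<ge> 0"
    using le by (metis ennreal_cases ennreal_neq_top top.extremum_uniqueI)
  then have "nonneg_sum (\<lambda>i. (f i)\<^sup>2) I \<le> ennreal ((sqrt M)\<^sup>2)"
    by simp
  then have "c \<le> sqrt M"
    using c nonneg_sum_le_iff[of "sqrt M" f I] M(2) by simp
  then have "c\<^sup>2 \<le> M"
    using power_mono[of c "sqrt M" 2] assms(1) M(2) by simp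
  then show "ennreal (c\<^sup>2) \<le> nonneg_sum (\<lambda>i. (f i)\<^sup>2) I"
    by (simp add: M ennreal_leI)
qed

text \<open>Bounds written as squares become bounds on norms of finite analysis sequences, and
  extended reals disappear from the rest of the argument.\<close>

lemma is_frame_iff:
  assumes "a > 0" "b > 0"
  shows "is_frame I u (a\<^sup>2) (b\<^sup>2) \<longleftrightarrow> a \<le> b \<and>
    (\<forall>x J. finite J \<longrightarrow> J \<subseteq> I \<longrightarrow> L2_set (\<lambda>i. norm (qinner (u i) x)) J \<le> b * norm x) \<and>
    (\<forall>x h. (\<forall>J. finite J \<longrightarrow> J \<subseteq> I \<longrightarrow> L2_set (\<lambda>i. norm (qinner (u i) x)) J \<le> h)
      \<longrightarrow> a * norm x \<le> h)" (is "_ \<longleftrightarrow> _ \<and> (\<forall>x. ?U x) \<and> (\<forall>x. ?L x)")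
proof -
  let ?S = "\<lambda>x. nonneg_sum (\<lambda>i. (norm (qinner (u i) x))\<^sup>2) I"
  have U: "?S x \<le> ennreal (b\<^sup>2 * (norm x)\<^sup>2) \<longleftrightarrow> ?U x" for x
    using nonneg_sum_le_iff[of "b * norm x" "\<lambda>i. norm (qinner (u i) x)" I] assms
    by (simp add: power_mult_distrib)
  have L: "ennreal (a\<^sup>2 * (norm x)\<^sup>2) \<le> ?S x \<longleftrightarrow> ?L x"
    if "?S x \<le> ennreal (b\<^sup>2 * (norm x)\<^sup>2)" for x
    using le_nonneg_sum_iff[of "a * norm x" "b * norm x" "\<lambda>i. norm (qinner (u i) x)" I] assms that
    by (simp add: power_mult_distrib)
  have ab: "0 < a\<^sup>2 \<and> a\<^sup>2 \<le> b\<^sup>2 \<longleftrightarrow> a \<le> b"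
    using assms by (simp add: power_mono_iff)
  have "ennreal (a\<^sup>2 * (norm x)\<^sup>2) \<le> ?S x \<and> ?S x \<le> ennreal (b\<^sup>2 * (norm x)\<^sup>2)
      \<longleftrightarrow> ?U x \<and> ?L x" for x
    using U[of x] L[of x] by argo
  then show ?thesis
    by (simp only: is_frame_def ab all_conj_distrib flip: conj_assoc)
qed

text \<open>The radius \<open>norm x / a\<close> makes the support function at \<open>z\<close> at
  least \<open>norm x * norm z\<close> by the lower frame bound. By Cauchy-Schwarz no functional can
  then separate \<open>x\<close> from the ball.\<close>

lemma frame_synthesis_dense:
  assumes "is_frame I u (a\<^sup>2) (b\<^sup>2)" "a > 0" "b > 0"
  shows "x \<in> closure (synthesis_ball I u (norm x / a))"
proof (cases "x = 0")
  case True
  have "x \<in> synthesis_ball I u (norm x / a)"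
    using True synthesis_ballI[of "{}" I _ 0 u] by simp
  then show ?thesis
    using closure_subset by blast
next
  case False
  note frame = assms(1)[unfolded is_frame_iff[OF assms(2,3)]]
  let ?r = "norm x / a"
  have r: "?r > 0"
    using False assms by simp
  show ?thesis
  proof (rule mem_closure_if_not_separated[OF convex_synthesis_ball])
    show "bounded (synthesis_ball I u ?r)"
    proof (rule boundedI)
      fix k assume "k \<in> synthesis_ball I u ?r"
      then obtain J q where J: "finite J" "J \<subseteq> I" "L2_set (\<lambda>i. norm (q i)) J \<le> ?r"
        "k = (\<Sum>i\<in>J. u i *\<^sub>Q q i)"
        unfolding synthesis_ball_def by blast
      then have "norm k \<le> b * L2_set (\<lambda>i. norm (q i)) J"
        using frame assms(3) by (auto intro!: synthesis_bound)
      also have "\<dots> \<le> b * ?r"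
        using J assms(3) by (intro mult_left_mono) auto
      finally show "norm k \<le> b * ?r" .
    qed
    show "synthesis_ball I u ?r \<noteq> {}"
      using synthesis_ballI[of "{}" I _ ?r u] r by fastforce
    fix z h assume h: "\<And>k. k \<in> synthesis_ball I u ?r \<Longrightarrow> qRe (qinner z k) \<le> h"
    have "L2_set (\<lambda>i. norm (qinner (u i) z)) J \<le> h / ?r" if "finite J" "J \<subseteq> I" for J
      using analysis_le_if_synthesis_ball_le[OF that r, of u z h] h False assms(2)
      by (simp add: field_simps)
    then have "a * norm z \<le> h / ?r"
      using frame by blast
    then have "norm z * norm x \<le> h"
      using r assms(2) False by (simp add: field_simps)
    then show "qRe (qinner z x) \<le> h"
      using qRe_qinner_le_norm[of z x] by linarith
  qed
qed

section \<open>Perturbation\<close>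

lemma frame_perturbation:
  fixes u v :: "'i \<Rightarrow> 'v::right_quat_hilbert"
  assumes frame: "is_frame I u (a\<^sup>2) (b\<^sup>2)" and ab: "a > 0" "b > 0"
    and lm: "lam \<ge> 0" "mu \<ge> 0" "lam * a + mu < a"
    and pert: "\<And>J (q :: 'i \<Rightarrow> quat). finite J \<Longrightarrow> J \<subseteq> I \<Longrightarrow>
      norm (\<Sum>i\<in>J. (u i - v i) *\<^sub>Q q i)
        \<le> lam * norm (\<Sum>i\<in>J. u i *\<^sub>Q q i) + mu * L2_set (\<lambda>i. norm (q i)) J"
  shows "is_frame I v ((a - (lam * a + mu))\<^sup>2) ((b + (lam * b + mu))\<^sup>2)"
proof -
  note u = frame[unfolded is_frame_iff[OF ab]]
  have pos: "a - (lam * a + mu) > 0" "b + (lam * b + mu) > 0"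
    using lm ab by (auto intro: add_pos_nonneg)
  have diff: "norm ((\<Sum>i\<in>J. u i *\<^sub>Q q i) - (\<Sum>i\<in>J. v i *\<^sub>Q q i))
      \<le> lam * norm (\<Sum>i\<in>J. u i *\<^sub>Q q i) + mu * L2_set (\<lambda>i. norm (q i)) J"
    if "finite J" "J \<subseteq> I" for J and q :: "'i \<Rightarrow> quat"
    using pert[OF that, of q] by (simp add: scaleQ_diff_left sum_subtractf)
  \<comment> \<open>The hypothesis controls synthesis by \<open>v\<close>, so the bound is proved
    there and carried over to analysis by duality.\<close>
  have upper: "L2_set (\<lambda>i. norm (qinner (v i) x)) J \<le> (b + (lam * b + mu)) * norm x"
    if J: "finite J" "J \<subseteq> I" for x J
  proof (rule analysis_bound)
    fix q :: "'i \<Rightarrow> quat"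
    let ?U = "\<Sum>i\<in>J. u i *\<^sub>Q q i" and ?V = "\<Sum>i\<in>J. v i *\<^sub>Q q i"
      and ?s = "L2_set (\<lambda>i. norm (q i)) J"
    have U: "norm ?U \<le> b * ?s"
      using u J ab by (intro synthesis_bound) auto
    have "norm ?V \<le> norm ?U + norm (?U - ?V)"
      using norm_triangle_ineq4[of ?U "?U - ?V"] by simp
    also have "\<dots> \<le> norm ?U + (lam * norm ?U + mu * ?s)"
      using diff[OF J] by simp
    also have "\<dots> \<le> b * ?s + (lam * (b * ?s) + mu * ?s)"
      using U lm by (intro add_mono mult_left_mono) auto
    finally show "norm ?V \<le> (b + (lam * b + mu)) * ?s"
      by (simp add: algebra_simps)
  qed (use pos in simp)
  have lower: "(a - (lam * a + mu)) * norm x \<le> h"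
    if h: "\<And>J. finite J \<Longrightarrow> J \<subseteq> I \<Longrightarrow> L2_set (\<lambda>i. norm (qinner (v i) x)) J \<le> h" for x h
  proof (cases "x = 0")
    case True
    then show ?thesis
      using h[of "{}"] by simp
  next
    case False
    let ?n = "norm x"
    have n: "?n > 0"
      using False by simp
    have h0: "h \<ge> 0"
      using h[of "{}"] by simp
    have "(a - (lam * a + mu)) * ?n \<le> h + e" if "e > 0" for e
    proof -
      \<comment> \<open>Approximating \<open>x\<close> within \<open>d\<close> costs
        \<open>d\<close> directly and \<open>lam * d\<close> through \<open>norm k\<close>; after
        multiplication by \<open>a\<close> the total is exactly \<open>e\<close>.\<close>
      define d where "d = e / (a * (1 + lam))"
      have d: "d > 0" "a * (1 + lam) * d = e"
        using that ab lm by (auto simp: d_def)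
      obtain k where "k \<in> synthesis_ball I u (?n / a)" "dist k x < d"
        using frame_synthesis_dense[OF frame ab, of x] d(1) unfolding closure_approachable by blast
      then obtain J q where J: "finite J" "J \<subseteq> I" and q: "L2_set (\<lambda>i. norm (q i)) J \<le> ?n / a"
        and k: "k = (\<Sum>i\<in>J. u i *\<^sub>Q q i)" "norm (x - k) \<le> d"
        unfolding synthesis_ball_def dist_norm by (force simp: norm_minus_commute)
      \<comment> \<open>The same coefficients with \<open>v\<close> in place of \<open>u\<close>.
        The square of \<open>norm x\<close> is split as the pairings of \<open>x\<close> with
        \<open>x - ?w\<close>, small by perturbation, and with \<open>?w\<close>, bounded through
        \<open>h\<close>.\<close>
      let ?w = "\<Sum>i\<in>J. v i *\<^sub>Q q i"
      have "norm k \<le> ?n + d"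
        using k(2) norm_triangle_ineq2[of k x] by (simp add: norm_minus_commute)
      then have "norm (k - ?w) \<le> lam * (?n + d) + mu * (?n / a)"
        using diff[OF J, of q] q lm mult_left_mono[of "norm k" "?n + d" lam]
          mult_left_mono[OF q, of mu]
        by (simp add: k(1))
      then have "norm (x - ?w) \<le> d + (lam * (?n + d) + mu * (?n / a))"
        using k(2) norm_triangle_ineq[of "x - k" "k - ?w"] by simp
      then have "qRe (qinner x (x - ?w)) \<le> ?n * (d + (lam * (?n + d) + mu * (?n / a)))"
        by (intro order_trans[OF qRe_qinner_le_norm] mult_left_mono) auto
      moreover have "qRe (qinner x ?w) \<le> h * (?n / a)"
        using qRe_qinner_synthesis_le[of x v q J]
          mult_mono[OF h[OF J] q h0 L2_set_nonneg] by linarith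
      ultimately have "?n * ?n \<le> ?n * (d + (lam * (?n + d) + mu * (?n / a)) + h / a)"
        by (simp add: qinner_diff_right power2_norm_eq_qinner algebra_simps flip: power2_eq_square)
      then have "?n \<le> d + (lam * (?n + d) + mu * (?n / a)) + h / a"
        using n by simp
      then have "a * ?n \<le> a * (d + (lam * (?n + d) + mu * (?n / a)) + h / a)"
        using ab by simp
      also have "\<dots> = a * (1 + lam) * d + (lam * a + mu) * ?n + h"
        using ab by (simp add: field_simps)
      also have "\<dots> = e + (lam * a + mu) * ?n + h"
        by (simp only: d(2))
      finally show ?thesis
        by (simp add: algebra_simps)
    qed
    then show ?thesis
      by (rule field_le_epsilon)
  qed
  have "a \<le> b"
    using u by blast
  moreover have "0 \<le> lam * a" "0 \<le> lam * b"
    using lm ab by auto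
  ultimately have "a - (lam * a + mu) \<le> b + (lam * b + mu)"
    using lm(2) by linarith
  then show ?thesis
    unfolding is_frame_iff[OF pos] using upper lower by blast
qed

theorem theorem4p1:
  fixes I :: "'i set"
    and u v :: "'i \<Rightarrow> 'v::right_quat_hilbert"
    and A B lam mu :: real
  assumes "separable_space (euclidean :: 'v topology)"
    and "I \<noteq> {}"
    and "is_frame I u A B"
    and "lam \<ge> 0" and "mu \<ge> 0"
    and "lam + mu / sqrt A < 1"
    and "\<And>J (q :: 'i \<Rightarrow> quat). finite J \<Longrightarrow> J \<subseteq> I \<Longrightarrow>
           norm (\<Sum>i\<in>J. (u i - v i) *\<^sub>Q q i)
             \<le> lam * norm (\<Sum>i\<in>J. u i *\<^sub>Q q i) + mu * sqrt (\<Sum>i\<in>J. (norm (q i))\<^sup>2)"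
  shows "is_frame I v (A * (1 - (lam + mu / sqrt A))\<^sup>2) (B * (1 + (lam + mu / sqrt B))\<^sup>2)"
proof -
  have AB: "A > 0" "B > 0"
    using assms(3) unfolding is_frame_def by auto
  \<comment> \<open>With square roots, \<open>A * (1 - (lam + mu / sqrt A))\<^sup>2\<close> is the
    square of \<open>a - (lam * a + mu)\<close>, and similarly for \<open>B\<close>.\<close>
  define a b where "a = sqrt A" and "b = sqrt B"
  have ab: "a > 0" "b > 0" "a\<^sup>2 = A" "b\<^sup>2 = B"
    using AB by (simp_all add: a_def b_def)
  have "lam * a + mu < a"
    using assms(6) ab(1) by (simp add: field_simps flip: a_def)
  then have "is_frame I v ((a - (lam * a + mu))\<^sup>2) ((b + (lam * b + mu))\<^sup>2)"
    using assms(3,4,5,7) ab by (intro frame_perturbation) (simp_all add: L2_set_def)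
  moreover have "a - (lam * a + mu) = a * (1 - (lam + mu / a))"
    "b + (lam * b + mu) = b * (1 + (lam + mu / b))"
    using ab by (simp_all add: field_simps)
  ultimately show ?thesis
    using ab by (simp add: power_mult_distrib flip: a_def b_def)
qed

end
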